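(* Let $Q$, $\alpha$ and $K\ge 2$ be positive integers with $\alpha<\frac Q2$ and $Q+\alpha$ even. Let $\mathbf P^{(2)}_\alpha$ be the $Q\times Q$ array defined in the context, and let $\mathbf P$ be the $K\times K$ block array whose diagonal blocks are all equal to $\mathbf P^{(2)}_\alpha$ and whose off-diagonal blocks are all equal to the $Q\times Q$ array with every entry $*$. Then $\mathbf P$ is a $$\left(KQ,\;KQ,\;(K-1)Q+\alpha,\;\frac{Q(Q-\alpha)}2\right)$$ PDA.
   Context: Notation: $[n]=\{1,\dots,n\}$; for integers $a\in[2b]$, $[a]_b=a$ if $a\le b$ and $[a]_b=a-b$ otherwise. **Placement delivery array (PDA).** For positive integers $K,F,Z,S$, an $F\times K$ array $P=[p_{f,k}]$, $f\in[F]$, $k\in[K]$, whose entries are either the special symbol $*$ or integers in $[S]$, is a $(K,F,Z,S)$ PDA if: - (A1) the symbol $*$ appears exactly $Z$ times in each column; - (A2) each integer in $[S]$ occurs at least once in the array; - (A3) for any two distinct entries with $p_{f_1,k_1}=p_{f_2,k_2}=s$ an integer, one has $f_1\neq f_2$, $k_1\neq k_2$, and $p_{f_1,k_2}=p_{f_2,k_1}=*$. **The array $\mathbf P^{(2)}_\alpha$.** Let $m=\frac{Q+\alpha}2$. Define a $Q\times Q$ array $B=(b_{r,c})$: rows $1,\dots,\alpha$ consist of the symbol $*$; for $r\in\{\alpha+1,\dots,m\}$ and $c\in[Q]$, $b_{r,c}=(r-\alpha-1)Q+c$; for $j\in\{1,\dots,m-\alpha\}$ and $c\in[Q]$, $b_{m+j,\,[c+m-j]_Q}=b_{m-j+1,\,c}$.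 Then $\mathbf P^{(2)}_\alpha=(p_{r,c})$ is obtained by cyclically shifting column $c$ of $B$ downwards by $c-1$ positions, i.e. $p_{[r+c-1]_Q,\,c}=b_{r,c}$ for all $r,c\in[Q]$. *)

theory Defs
  imports Complex_Main
begin

text \<open>
  An \<open>F \<times> K\<close> array is a function of a row and a column index, read only at the
  1-based positions in \<open>{1..F} \<times> {1..K}\<close>.
\<close>

datatype entry = Star | Num nat

type_synonym array = "nat \<Rightarrow> nat \<Rightarrow> entry"

definition is_PDA :: "nat \<Rightarrow> nat \<Rightarrow> nat \<Rightarrow> nat \<Rightarrow> array \<Rightarrow> bool" where
  "is_PDA K F Z S P \<longleftrightarrow>
     0 < K \<and> 0 < F \<and> 0 < Z \<and> 0 < S \<and>
     (\<forall>f\<in>{1..F}. \<forall>k\<in>{1..K}. P f k = Star \<or> (\<exists>s\<in>{1..S}. P f k = Num s)) \<and>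
     (\<forall>k\<in>{1..K}. card {f\<in>{1..F}. P f k = Star} = Z) \<and>
     (\<forall>s\<in>{1..S}. \<exists>f\<in>{1..F}. \<exists>k\<in>{1..K}. P f k = Num s) \<and>
     (\<forall>f1\<in>{1..F}. \<forall>k1\<in>{1..K}. \<forall>f2\<in>{1..F}. \<forall>k2\<in>{1..K}. \<forall>s.
        (f1, k1) \<noteq> (f2, k2) \<and> P f1 k1 = Num s \<and> P f2 k2 = Num s \<longrightarrow>
        f1 \<noteq> f2 \<and> k1 \<noteq> k2 \<and> P f1 k2 = Star \<and> P f2 k1 = Star)"

text \<open>\<open>wrap b a\<close> is $[a]_b$; it is used only for \<open>a \<in> {1..2 * b}\<close>.\<close>

definition wrap :: "nat \<Rightarrow> nat \<Rightarrow> nat" where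
  "wrap b a = (if a \<le> b then a else a - b)"

text \<open>
  The array $B$, with $m = (Q + \alpha)/2$. Its rows below $m$ are given by
  $b_{m+j,[c+m-j]_Q} = b_{m-j+1,c}$, so the entry at \<open>(m + j, d)\<close> is found by
  solving \<open>d = [c + m - j]_Q\<close> for \<open>c\<close>; see \<open>base_array_lower\<close> below.
\<close>

definition base_upper :: "nat \<Rightarrow> nat \<Rightarrow> array" where
  "base_upper Q \<alpha> r c = (if r \<le> \<alpha> then Star else Num ((r - \<alpha> - 1) * Q + c))"

definition base_array :: "nat \<Rightarrow> nat \<Rightarrow> array" where
  "base_array Q \<alpha> r d =
     (let m = (Q + \<alpha>) div 2 in
      if r \<le> m then base_upper Q \<alpha> r d
      else let j = r - m in
        base_upper Q \<alpha> (m - j + 1) (THE c. c \<in> {1..Q} \<and> wrap Q (c + m - j) = d))"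

text \<open>Column \<open>c\<close> is shifted cyclically downwards by \<open>c - 1\<close>; see \<open>shift_columns_wrap\<close>.\<close>

definition shift_columns :: "nat \<Rightarrow> array \<Rightarrow> array" where
  "shift_columns Q B i c = B (THE r. r \<in> {1..Q} \<and> wrap Q (r + c - 1) = i) c"

definition P2 :: "nat \<Rightarrow> nat \<Rightarrow> array" where
  "P2 Q \<alpha> = shift_columns Q (base_array Q \<alpha>)"

text \<open>
  The array assembled from \<open>Q \<times> Q\<close> blocks; \<open>blk i j\<close> is the block in block row \<open>i\<close>
  and block column \<open>j\<close>, both counted from 1.
\<close>

definition block_array :: "nat \<Rightarrow> (nat \<Rightarrow> nat \<Rightarrow> array) \<Rightarrow> array" where
  "block_array Q blk f k =
     blk ((f - 1) div Q + 1) ((k - 1) div Q + 1) ((f - 1) mod Q + 1) ((k - 1) mod Q + 1)"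

definition block_diagonal :: "nat \<Rightarrow> array \<Rightarrow> array" where
  "block_diagonal Q A = block_array Q (\<lambda>i j. if i = j then A else (\<lambda>_ _. Star))"

text \<open>The defining equations of $B$ and of the shifted array, as stated mathematically.\<close>

lemma wrap_inj:
  assumes "a \<in> {1..Q}" "a' \<in> {1..Q}" "wrap Q (a + t) = wrap Q (a' + t)" "t \<le> Q"
  shows "a = a'"
  using assms by (auto simp: wrap_def split: if_splits)

lemma base_array_star: "r \<le> \<alpha> \<Longrightarrow> \<alpha> \<le> Q \<Longrightarrow> base_array Q \<alpha> r c = Star"
  by (auto simp: base_array_def base_upper_def Let_def)

lemma base_array_upper:
  assumes "r \<in> {\<alpha> + 1..(Q + \<alpha>) div 2}"
  shows "base_array Q \<alpha> r c = Num ((r - \<alpha> - 1) * Q + c)"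
  using assms by (auto simp: base_array_def base_upper_def Let_def)

lemma base_array_lower:
  assumes "m = (Q + \<alpha>) div 2" "\<alpha> \<le> Q" "j \<in> {1..m - \<alpha>}" "c \<in> {1..Q}"
  shows "base_array Q \<alpha> (m + j) (wrap Q (c + m - j)) = base_array Q \<alpha> (m - j + 1) c"
proof -
  have jm: "j \<le> m" "m - j \<le> Q" using assms by auto
  have "(THE c'. c' \<in> {1..Q} \<and> wrap Q (c' + m - j) = wrap Q (c + m - j)) = c"
  proof (rule the_equality)
    fix c' assume c': "c' \<in> {1..Q} \<and> wrap Q (c' + m - j) = wrap Q (c + m - j)"
    then have "wrap Q (c' + (m - j)) = wrap Q (c + (m - j))" using jm by simp
    then show "c' = c" using wrap_inj c' assms(4) jm by blast
  qed (use assms in auto)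
  then show ?thesis
    using assms jm by (auto simp: base_array_def Let_def)
qed

lemma shift_columns_wrap:
  assumes "r \<in> {1..Q}" "c \<in> {1..Q}"
  shows "shift_columns Q B (wrap Q (r + c - 1)) c = B r c"
proof -
  have "(THE r'. r' \<in> {1..Q} \<and> wrap Q (r' + c - 1) = wrap Q (r + c - 1)) = r"
  proof (rule the_equality)
    fix r' assume r': "r' \<in> {1..Q} \<and> wrap Q (r' + c - 1) = wrap Q (r + c - 1)"
    then have "wrap Q (r' + (c - 1)) = wrap Q (r + (c - 1))" using assms by simp
    moreover have "c - 1 \<le> Q" using assms by auto
    ultimately show "r' = r" using wrap_inj r' assms by blast
  qed (use assms in auto)
  then show ?thesis by (simp add: shift_columns_def)
qed

end

theory Submission
  imports Defs
begin

text \<open>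
  Write an integer of the array as \<open>t * Q + c\<close> with \<open>c \<in> {1..Q}\<close>. Modulo \<open>Q\<close>, it occupies exactly
  the positions \<open>(c + \<alpha> + t, c)\<close> and \<open>(c + \<alpha> - 1, c + \<alpha> + t)\<close> of \<open>P2\<close>, whereas the stars are the
  positions \<open>(i, c)\<close> with \<open>i - c\<close> in \<open>{0..<\<alpha>}\<close>. The two opposite corners
  \<open>(c + \<alpha> + t, c + \<alpha> + t)\<close> and \<open>(c + \<alpha> - 1, c)\<close> lie on the first and the last of these star
  diagonals. In the block array, the corners spanned by equal integers of different
  diagonal blocks lie in off-diagonal blocks.
\<close>

section \<open>Division with remainder in \<open>{1..Q}\<close>, used for integer labels and for
  block indices\<close>

lemma mult_add_div_mod:
  fixes Q :: nat
  assumes "c \<in> {1..Q}"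
  shows "(t * Q + c - 1) div Q = t" "(t * Q + c - 1) mod Q + 1 = c"
  using assms by (cases c; simp)+

lemma mult_add_eq_iff:
  fixes Q :: nat
  assumes "c \<in> {1..Q}" "c' \<in> {1..Q}"
  shows "t * Q + c = t' * Q + c' \<longleftrightarrow> t = t' \<and> c = c'"
  using mult_add_div_mod[OF assms(1)] mult_add_div_mod[OF assms(2)] by metis

lemma mult_add_cases:
  fixes Q :: nat
  assumes "s \<in> {1..K * Q}"
  obtains t c where "t < K" "c \<in> {1..Q}" "s = t * Q + c"
proof
  have Q: "0 < Q" using assms by (cases "Q = 0") auto
  show "(s - 1) div Q < K" using assms Q by (auto simp: less_mult_imp_div_less)
  show "(s - 1) mod Q + 1 \<in> {1..Q}" using Q by (auto simp: Suc_le_eq)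
  show "s = (s - 1) div Q * Q + ((s - 1) mod Q + 1)"
    using assms div_mult_mod_eq[of "s - 1" Q] by simp
qed

lemma mult_add_mem:
  fixes Q :: nat
  assumes "t < K" "c \<in> {1..Q}"
  shows "t * Q + c \<in> {1..K * Q}"
proof -
  have "(t + 1) * Q \<le> K * Q" using assms by (intro mult_right_mono) auto
  then show ?thesis using assms by simp
qed

section \<open>Block-diagonal arrays over an arbitrary square PDA\<close>

lemma block_diagonal_apply:
  assumes "i \<in> {1..Q}" "c \<in> {1..Q}"
  shows "block_diagonal Q A (u * Q + i) (v * Q + c) = (if u = v then A i c else Star)"
  unfolding block_diagonal_def block_array_def mult_add_div_mod[OF assms(1)]
    mult_add_div_mod[OF assms(2)] by simp

text \<open>Each column meets one diagonal block, with \<open>Z\<close> stars, and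
  \<open>K - 1\<close> all-star blocks, with \<open>Q\<close> stars each. All diagonal blocks are
  copies of \<open>A\<close>, so no new integers arise.\<close>

lemma is_PDA_block_diagonal:
  assumes A: "is_PDA Q Q Z S A" and K: "0 < K"
  shows "is_PDA (K * Q) (K * Q) ((K - 1) * Q + Z) S (block_diagonal Q A)"
proof -
  let ?P = "block_diagonal Q A"
  have pos: "0 < Q" "0 < Z" "0 < S"
    and entry: "\<And>i c. i \<in> {1..Q} \<Longrightarrow> c \<in> {1..Q} \<Longrightarrow> A i c = Star \<or> (\<exists>s\<in>{1..S}. A i c = Num s)"
    and star: "\<And>c. c \<in> {1..Q} \<Longrightarrow> card {i\<in>{1..Q}. A i c = Star} = Z"
    and ex: "\<And>s. s \<in> {1..S} \<Longrightarrow> \<exists>i\<in>{1..Q}. \<exists>c\<in>{1..Q}. A i c = Num s"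
    using A unfolding is_PDA_def by blast+
  have A3: "i \<noteq> i' \<and> c \<noteq> c' \<and> A i c' = Star \<and> A i' c = Star"
    if "i \<in> {1..Q}" "c \<in> {1..Q}" "i' \<in> {1..Q}" "c' \<in> {1..Q}"
      "(i, c) \<noteq> (i', c')" "A i c = Num s" "A i' c' = Num s" for i c i' c' s
    using A that unfolding is_PDA_def by blast
  have P_entry: "?P f k = Star \<or> (\<exists>s\<in>{1..S}. ?P f k = Num s)"
    if f: "f \<in> {1..K * Q}" and k: "k \<in> {1..K * Q}" for f k
  proof -
    obtain u i where "i \<in> {1..Q}" "f = u * Q + i" using f by (rule mult_add_cases)
    moreover obtain v c where "c \<in> {1..Q}" "k = v * Q + c" using k by (rule mult_add_cases)
    ultimately show ?thesis using entry by (simp add: block_diagonal_apply)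
  qed
  have P_card: "card {f\<in>{1..K * Q}. ?P f k = Star} = (K - 1) * Q + Z"
    if k: "k \<in> {1..K * Q}" for k
  proof -
    obtain v c where v: "v < K" and c: "c \<in> {1..Q}" and k_eq: "k = v * Q + c"
      using k by (rule mult_add_cases)
    \<comment> \<open>Stars are counted through the complement: the integers of column
      \<open>k\<close> all lie in diagonal block \<open>v\<close>, so their rows are the translate
      of \<open>?N\<close> by \<open>v * Q\<close>.\<close>
    let ?N = "{i\<in>{1..Q}. A i c \<noteq> Star}"
    have "{1..Q} = {i\<in>{1..Q}. A i c = Star} \<union> ?N" by auto
    then have "card {1..Q} = card {i\<in>{1..Q}. A i c = Star} + card ?N"
      by (metis (no_types, lifting) card_Un_disjoint disjoint_iff finite_Un finite_atLeastAtMost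
          mem_Collect_eq)
    then have N: "Q = Z + card ?N" using star[OF c] by simp
    have "{1..K * Q} - (\<lambda>i. v * Q + i) ` ?N = {f\<in>{1..K * Q}. ?P f k = Star}" (is "?L = ?R")
    proof (intro set_eqI)
      fix f
      show "f \<in> ?L \<longleftrightarrow> f \<in> ?R"
      proof (cases "f \<in> {1..K * Q}")
        case True
        then obtain u i where u: "u < K" and i: "i \<in> {1..Q}" and f: "f = u * Q + i"
          by (rule mult_add_cases)
        have "f \<in> (\<lambda>i. v * Q + i) ` ?N \<longleftrightarrow> u = v \<and> A i c \<noteq> Star"
          using mult_add_eq_iff[OF i] i by (auto simp: f image_iff)
        then show ?thesis using True i c by (auto simp: f k_eq block_diagonal_apply)
      qed auto
    qed
    moreover have "card ?L = K * Q - card ((\<lambda>i. v * Q + i) ` ?N)"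
      using mult_add_mem[OF v] by (subst card_Diff_subset) auto
    moreover have "card ((\<lambda>i. v * Q + i) ` ?N) = card ?N"
      by (intro card_image) (auto simp: inj_on_def)
    moreover have "K * Q = (K - 1) * Q + Q" using K by (cases K) auto
    ultimately show ?thesis using N by simp
  qed
  have P_ex: "\<exists>f\<in>{1..K * Q}. \<exists>k\<in>{1..K * Q}. ?P f k = Num s" if s: "s \<in> {1..S}" for s
  proof -
    obtain i c where ic: "i \<in> {1..Q}" "c \<in> {1..Q}" "A i c = Num s" using ex[OF s] by blast
    \<comment> \<open>The first diagonal block already contains every integer.\<close>
    have "?P (0 * Q + i) (0 * Q + c) = Num s"
      unfolding block_diagonal_apply[OF ic(1,2)] using ic by simp
    then show ?thesis using mult_add_mem[OF K] ic by blast
  qed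
  have P_A3: "f1 \<noteq> f2 \<and> k1 \<noteq> k2 \<and> ?P f1 k2 = Star \<and> ?P f2 k1 = Star"
    if *: "f1 \<in> {1..K * Q}" "k1 \<in> {1..K * Q}" "f2 \<in> {1..K * Q}" "k2 \<in> {1..K * Q}"
      "(f1, k1) \<noteq> (f2, k2)" "?P f1 k1 = Num s" "?P f2 k2 = Num s" for f1 k1 f2 k2 s
  proof -
    obtain u1 i1 where i1: "i1 \<in> {1..Q}" and f1: "f1 = u1 * Q + i1" using *(1) by (rule mult_add_cases)
    obtain v1 c1 where c1: "c1 \<in> {1..Q}" and k1: "k1 = v1 * Q + c1" using *(2) by (rule mult_add_cases)
    obtain u2 i2 where i2: "i2 \<in> {1..Q}" and f2: "f2 = u2 * Q + i2" using *(3) by (rule mult_add_cases)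
    obtain v2 c2 where c2: "c2 \<in> {1..Q}" and k2: "k2 = v2 * Q + c2" using *(4) by (rule mult_add_cases)
    note [simp] = f1 f2 k1 k2 block_diagonal_apply i1[simplified] i2[simplified] c1[simplified] c2[simplified]
    \<comment> \<open>Integers occur only in diagonal blocks. If \<open>u1\<close> and
      \<open>u2\<close> differ, the corners therefore lie in off-diagonal blocks.\<close>
    have 1: "v1 = u1" "A i1 c1 = Num s" "v2 = u2" "A i2 c2 = Num s"
      using *(6,7) by (auto split: if_splits)
    show ?thesis
    proof (cases "u1 = u2")
      case True
      then show ?thesis using A3[OF i1 c1 i2 c2 _ 1(2,4)] *(5) 1 by auto
    next
      case False
      then show ?thesis
        using 1 mult_add_eq_iff[OF i1 i2] mult_add_eq_iff[OF c1 c2] by auto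
    qed
  qed
  have KQ: "0 < K * Q" "0 < (K - 1) * Q + Z" using pos K by simp_all
  show ?thesis
    unfolding is_PDA_def
    by (intro conjI ballI allI P_entry P_card P_ex pos KQ; assumption?) (use P_A3 in blast)
qed

section \<open>Positions of stars and integers in \<open>P2\<close>\<close>

lemma wrap_mem: "a \<in> {1..2 * Q} \<Longrightarrow> wrap Q a \<in> {1..Q}"
  by (auto simp: wrap_def)

text \<open>Turns a congruence modulo \<open>Q\<close> into two linear equations that arithmetic can
  decide.\<close>

lemma wrap_eq_iff:
  assumes "0 < a" "b \<in> {1..Q}"
  shows "wrap Q a = b \<longleftrightarrow> a = b \<or> a = b + Q"
  using assms by (auto simp: wrap_def)

text \<open>\<open>wrap Q (i + Q + 1 - c)\<close> is the row that the shift of column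
  \<open>c\<close> by \<open>c - 1\<close> moves to row \<open>i\<close>. The summand
  \<open>Q\<close> keeps the subtraction from truncating.\<close>

lemma shift_index:
  assumes "i \<in> {1..Q}" "c \<in> {1..Q}"
  shows "wrap Q (i + Q + 1 - c) \<in> {1..Q}"
    and "wrap Q (i + Q + 1 - c) + c = i + 1 \<or> wrap Q (i + Q + 1 - c) + c = i + Q + 1"
proof -
  show *: "wrap Q (i + Q + 1 - c) \<in> {1..Q}" using assms by (intro wrap_mem) auto
  show "wrap Q (i + Q + 1 - c) + c = i + 1 \<or> wrap Q (i + Q + 1 - c) + c = i + Q + 1"
    using wrap_eq_iff[OF _ *, of "i + Q + 1 - c"] assms by auto
qed

text \<open>Resolves both definite descriptions: \<open>r\<close> is the row before the shift, and
  in the rows below \<open>\<alpha> + h\<close> the source row and source column are computed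
  explicitly.\<close>

lemma P2_apply:
  assumes Q: "Q = \<alpha> + 2 * h" and i: "i \<in> {1..Q}" and c: "c \<in> {1..Q}"
  defines "r \<equiv> wrap Q (i + Q + 1 - c)"
  shows "P2 Q \<alpha> i c =
    (if r \<le> \<alpha> then Star
     else if r \<le> \<alpha> + h then Num ((r - \<alpha> - 1) * Q + c)
     else Num ((Q - r) * Q + wrap Q (c + r - \<alpha>)))"
proof -
  have r: "r \<in> {1..Q}" and rc: "r + c = i + 1 \<or> r + c = i + Q + 1"
    unfolding r_def using shift_index[OF i c] by auto
  have i_eq: "wrap Q (r + c - 1) = i" using rc i c by (subst wrap_eq_iff) auto
  have m: "\<alpha> + h = (Q + \<alpha>) div 2" using Q by simp
  have P2: "P2 Q \<alpha> i c = base_array Q \<alpha> r c"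
    unfolding P2_def using shift_columns_wrap[OF r c] i_eq by metis
  consider "r \<le> \<alpha>" | "\<alpha> < r" "r \<le> \<alpha> + h" | "\<alpha> + h < r" by linarith
  then show ?thesis
  proof cases
    case 1
    then show ?thesis using base_array_star Q P2 by simp
  next
    case 2
    then show ?thesis using base_array_upper[of r \<alpha> Q c] P2 Q by simp
  next
    case 3
    define j where "j = r - (\<alpha> + h)"
    \<comment> \<open>The source column \<open>?d\<close> must satisfy
      \<open>wrap Q (?d + (\<alpha> + h) - j) = c\<close>. As \<open>Q = \<alpha> + 2 * h\<close>,
      subtracting \<open>\<alpha> + h - j\<close> amounts to adding
      \<open>h + j = r - \<alpha>\<close> modulo \<open>Q\<close>.\<close>
    let ?d = "wrap Q (c + r - \<alpha>)"
    have j: "j \<in> {1..\<alpha> + h - \<alpha>}" "\<alpha> + h + j = r" using 3 r Q by (auto simp: j_def)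
    have d: "?d \<in> {1..Q}" using 3 c r Q by (intro wrap_mem) auto
    have "c + r - \<alpha> = ?d \<or> c + r - \<alpha> = ?d + Q" using wrap_eq_iff[OF _ d, of "c + r - \<alpha>"] 3 by auto
    then have "wrap Q (?d + (\<alpha> + h) - j) = c" using 3 c d j Q by (subst wrap_eq_iff) auto
    with base_array_lower[OF m _ j(1) d] j Q
    have "P2 Q \<alpha> i c = base_array Q \<alpha> (\<alpha> + h - j + 1) ?d" using P2 by simp
    also have "\<dots> = Num ((\<alpha> + h - j + 1 - \<alpha> - 1) * Q + ?d)"
      by (rule base_array_upper) (use j Q in auto)
    also have "\<alpha> + h - j + 1 - \<alpha> - 1 = Q - r" using j Q by auto
    finally show ?thesis using 3 by simp
  qed
qed

lemma P2_eq_Star_iff: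
  assumes "Q = \<alpha> + 2 * h" "i \<in> {1..Q}" "c \<in> {1..Q}"
  shows "P2 Q \<alpha> i c = Star \<longleftrightarrow> wrap Q (i + Q + 1 - c) \<le> \<alpha>"
  using P2_apply[OF assms] by auto

text \<open>The first position comes from the unshifted row \<open>\<alpha> + 1 + t\<close>, the
  second from its copy in row \<open>Q - t\<close>.\<close>

lemma P2_eq_Num_iff:
  assumes Q: "Q = \<alpha> + 2 * h" and i: "i \<in> {1..Q}" and c: "c \<in> {1..Q}"
    and a: "0 < \<alpha>" and t: "t < h" and d: "d \<in> {1..Q}"
  shows "P2 Q \<alpha> i c = Num (t * Q + d) \<longleftrightarrow>
    i = wrap Q (d + \<alpha> + t) \<and> c = d \<or> i = wrap Q (d + \<alpha> - 1) \<and> c = wrap Q (d + \<alpha> + t)"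
proof -
  define r where "r = wrap Q (i + Q + 1 - c)"
  have r: "r \<in> {1..Q}" and rc: "r + c = i + 1 \<or> r + c = i + Q + 1"
    unfolding r_def using shift_index[OF i c] by auto
  have low: "wrap Q (c + r - \<alpha>) \<in> {1..Q}" if "\<not> r \<le> \<alpha>"
    using that c r by (intro wrap_mem) auto
  have u: "wrap Q (c + r - \<alpha>) = d \<longleftrightarrow> c + r - \<alpha> = d \<or> c + r - \<alpha> = d + Q" if "r + t = Q"
    using that c d t Q by (intro wrap_eq_iff) auto
  have w: "wrap Q (d + \<alpha> + t) = x \<longleftrightarrow> d + \<alpha> + t = x \<or> d + \<alpha> + t = x + Q"
    if "x \<in> {1..Q}" for x using that a by (intro wrap_eq_iff) auto
  have v: "wrap Q (d + \<alpha> - 1) = i \<longleftrightarrow> d + \<alpha> - 1 = i \<or> d + \<alpha> - 1 = i + Q"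
    using i a d by (intro wrap_eq_iff) auto
  have "P2 Q \<alpha> i c = Num (t * Q + d) \<longleftrightarrow>
      \<not> r \<le> \<alpha> \<and> (if r \<le> \<alpha> + h then r - \<alpha> - 1 = t \<and> c = d
                 else Q - r = t \<and> wrap Q (c + r - \<alpha>) = d)"
    unfolding P2_apply[OF Q i c, folded r_def]
    using mult_add_eq_iff[OF c d] mult_add_eq_iff[OF low d] by auto
  \<comment> \<open>By \<open>t < h\<close>, the first of these rows is at most
    \<open>\<alpha> + h\<close> and the second lies beyond it.\<close>
  also have "\<dots> \<longleftrightarrow> r = \<alpha> + 1 + t \<and> c = d \<or> r = Q - t \<and> wrap Q (c + r - \<alpha>) = d"
    using t r Q by auto
  also have "r = \<alpha> + 1 + t \<and> c = d \<longleftrightarrow> i = wrap Q (d + \<alpha> + t) \<and> c = d"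
    using w[OF i] rc r c i d t Q by auto
  also have "r = Q - t \<and> wrap Q (c + r - \<alpha>) = d \<longleftrightarrow>
      r + t = Q \<and> (c + r = d + \<alpha> \<or> c + r = d + \<alpha> + Q)"
    using u t r Q by auto
  also have "\<dots> \<longleftrightarrow> i = wrap Q (d + \<alpha> - 1) \<and> c = wrap Q (d + \<alpha> + t)" (is "?A \<longleftrightarrow> ?B")
  proof -
    have B: "?B \<longleftrightarrow> (d + \<alpha> = i + 1 \<or> d + \<alpha> = i + Q + 1) \<and> (d + \<alpha> + t = c \<or> d + \<alpha> + t = c + Q)"
      using w[OF c] v a by auto
    \<comment> \<open>Each congruence is now a choice between two equations; the bounds exclude the
      incompatible combinations.\<close>
    have bounds: "1 \<le> r" "r \<le> Q" "1 \<le> c" "c \<le> Q" "1 \<le> i" "i \<le> Q" "1 \<le> d" "d \<le> Q"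
      using r c i d by auto
    show ?thesis
    proof
      assume ?A
      then show ?B unfolding B using rc bounds Q t a by (elim conjE disjE) simp_all
    next
      assume ?B
      then show ?A unfolding B using rc bounds Q t a by (elim conjE disjE) simp_all
    qed
  qed
  finally show ?thesis .
qed

text \<open>Supplies the form \<open>t * Q + d\<close> with \<open>t < h\<close> that
  \<open>P2_eq_Num_iff\<close> expects, and so bounds all integers by \<open>h * Q\<close>.\<close>

lemma P2_cases:
  assumes Q: "Q = \<alpha> + 2 * h" and i: "i \<in> {1..Q}" and c: "c \<in> {1..Q}"
  obtains "P2 Q \<alpha> i c = Star"
  | t d where "t < h" "d \<in> {1..Q}" "P2 Q \<alpha> i c = Num (t * Q + d)"
proof -
  define r where "r = wrap Q (i + Q + 1 - c)"
  have r: "r \<in> {1..Q}" unfolding r_def using i c by (rule shift_index)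
  note P = P2_apply[OF Q i c, folded r_def]
  consider "r \<le> \<alpha>" | "\<alpha> < r" "r \<le> \<alpha> + h" | "\<alpha> + h < r" by linarith
  then show thesis
  proof cases
    case 1
    then show thesis using that(1) P by simp
  next
    case 2
    then show thesis using that(2)[of "r - \<alpha> - 1" c] P c by auto
  next
    case 3
    moreover have "wrap Q (c + r - \<alpha>) \<in> {1..Q}" using 3 c r by (intro wrap_mem) auto
    ultimately show thesis using that(2)[of "Q - r" "wrap Q (c + r - \<alpha>)"] P r Q by auto
  qed
qed

lemma is_PDA_P2:
  assumes Q: "Q = \<alpha> + 2 * h" and a: "0 < \<alpha>" and h: "0 < h"
  shows "is_PDA Q Q \<alpha> (h * Q) (P2 Q \<alpha>)"
proof -
  let ?P = "P2 Q \<alpha>"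
  have P_entry: "?P i c = Star \<or> (\<exists>s\<in>{1..h * Q}. ?P i c = Num s)"
    if "i \<in> {1..Q}" "c \<in> {1..Q}" for i c
    using that by (rule P2_cases[OF Q]) (use mult_add_mem in blast)+
  have P_card: "card {i\<in>{1..Q}. ?P i c = Star} = \<alpha>" if c: "c \<in> {1..Q}" for c
  proof -
    have "{i\<in>{1..Q}. ?P i c = Star} = {i\<in>{1..Q}. wrap Q (i + Q + 1 - c) \<le> \<alpha>}"
      using P2_eq_Star_iff[OF Q _ c] by blast
    \<comment> \<open>The cyclic shift is injective on rows, so the \<open>\<alpha>\<close> star
      rows of the unshifted array give \<open>\<alpha>\<close> stars in column
      \<open>c\<close>.\<close>
    also have "\<dots> = (\<lambda>r. wrap Q (r + c - 1)) ` {1..\<alpha>}"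
    proof (intro equalityI subsetI)
      fix i assume "i \<in> {i\<in>{1..Q}. wrap Q (i + Q + 1 - c) \<le> \<alpha>}"
      then show "i \<in> (\<lambda>r. wrap Q (r + c - 1)) ` {1..\<alpha>}"
        using c by (intro image_eqI[of _ _ "wrap Q (i + Q + 1 - c)"]) (auto simp: wrap_def)
    qed (use c Q in \<open>auto simp: wrap_def\<close>)
    also have "card \<dots> = card {1..\<alpha>}"
      using c Q by (intro card_image) (auto simp: inj_on_def wrap_def split: if_splits)
    finally show ?thesis by simp
  qed
  have P_ex: "\<exists>i\<in>{1..Q}. \<exists>c\<in>{1..Q}. ?P i c = Num s" if s: "s \<in> {1..h * Q}" for s
  proof -
    obtain t d where t: "t < h" and d: "d \<in> {1..Q}" and s: "s = t * Q + d"
      using s by (rule mult_add_cases)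
    have i: "wrap Q (d + \<alpha> + t) \<in> {1..Q}" using t d Q by (auto simp: wrap_def)
    \<comment> \<open>The witness is the first of the two positions, in column
      \<open>d\<close>.\<close>
    show ?thesis using P2_eq_Num_iff[OF Q i d a t d] i d s by blast
  qed
  have P_A3: "i \<noteq> i' \<and> c \<noteq> c' \<and> ?P i c' = Star \<and> ?P i' c = Star"
    if *: "i \<in> {1..Q}" "c \<in> {1..Q}" "i' \<in> {1..Q}" "c' \<in> {1..Q}"
      "(i, c) \<noteq> (i', c')" "?P i c = Num s" "?P i' c' = Num s" for i c i' c' s
  proof -
    obtain t d where t: "t < h" and d: "d \<in> {1..Q}" and s: "s = t * Q + d"
      using *(6) by (auto intro: P2_cases[OF Q *(1,2)])
    let ?w = "wrap Q (d + \<alpha> + t)" and ?v = "wrap Q (d + \<alpha> - 1)"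
    \<comment> \<open>The two columns differ by \<open>\<alpha> + t\<close> and the two rows by
      \<open>t + 1\<close> modulo \<open>Q\<close>; both numbers lie strictly between
      \<open>0\<close> and \<open>Q\<close>.\<close>
    have w: "?w \<in> {1..Q}" "?w \<noteq> d" "?v \<in> {1..Q}" "?v \<noteq> ?w"
      using t d Q a by (auto simp: wrap_def split: if_splits)
    \<comment> \<open>Before the shift, these corners lie in rows \<open>1\<close> and
      \<open>\<alpha>\<close>, the first and last star rows.\<close>
    have "wrap Q (?w + Q + 1 - ?w) \<le> \<alpha>" "wrap Q (?v + Q + 1 - d) \<le> \<alpha>"
      using a d Q by (auto simp: wrap_def)
    then have "?P ?w ?w = Star" "?P ?v d = Star" using P2_eq_Star_iff[OF Q] w d by blast+
    moreover have "i = ?w \<and> c = d \<or> i = ?v \<and> c = ?w" "i' = ?w \<and> c' = d \<or> i' = ?v \<and> c' = ?w"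
      using P2_eq_Num_iff[OF Q _ _ a t d] * s by blast+
    ultimately show ?thesis using w *(5) by auto
  qed
  have pos: "0 < Q" "0 < h * Q" using a h Q by simp_all
  show ?thesis
    unfolding is_PDA_def
    by (intro conjI ballI allI P_entry P_card P_ex a pos; assumption?) (use P_A3 in blast)
qed

theorem mainTheorem4:
  fixes Q \<alpha> K :: nat
  assumes "0 < Q" and "0 < \<alpha>" and "2 \<le> K"
    and "real \<alpha> < real Q / 2" and "even (Q + \<alpha>)"
  shows "is_PDA (K * Q) (K * Q) ((K - 1) * Q + \<alpha>) (Q * (Q - \<alpha>) div 2)
           (block_diagonal Q (P2 Q \<alpha>))"
proof -
  \<comment> \<open>This is the number of integer rows in the upper part of the base array,
    \<open>(Q + \<alpha>) div 2 - \<alpha>\<close>; parity makes the division exact.\<close>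
  define h where "h = (Q - \<alpha>) div 2"
  have "\<alpha> < Q" using assms(4) by linarith
  then have "even (Q - \<alpha>)" using assms(5) by simp
  then have Q: "Q = \<alpha> + 2 * h" using \<open>\<alpha> < Q\<close> by (simp add: h_def)
  then have h: "0 < h" using \<open>\<alpha> < Q\<close> by simp
  have "Q - \<alpha> = 2 * h" using Q by simp
  then have "Q * (Q - \<alpha>) div 2 = h * Q" by simp
  then show ?thesis
    using is_PDA_block_diagonal[OF is_PDA_P2[OF Q assms(2) h], of K] assms(3) by simp
qed

end
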